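(* Let $(X,X_+,\mathcal K,f)$ be an abstract state space and let $P$ be a Markov projection on $X$. Then the set $\Sigma_P^{u}(X)$ is a norm dense and (norm) open subset of $\Sigma_P^{inv}(X)$.
   Context: Let $X$ be a real ordered vector space with generating cone $X_+$ ($X=X_+-X_+$), let $f$ be a strictly positive linear functional on $X$ ($f(x)>0$ for $x>0$), and let $\mathcal K=\{x\in X_+: f(x)=1\}$. Let $U$ be the convex hull of $\mathcal K\cup(-\mathcal K)$ and $\|x\|=\inf\{t\ge 0: x\in tU\}$. $(X,X_+,\mathcal K,f)$ is an abstract state space if this seminorm is a norm, $X$ is complete for it, and $X_+$ is closed; $X$ always carries this norm. A linear operator $T:X\to X$ is Markov if it is positive and $T(\mathcal K)\subset\mathcal K$; a Markov projection is a Markov operator $P$ with $P^2=P$. $\Sigma_P(X)$ is the set of Markov operators $T$ on $X$ with $TP=PT$. $\Sigma_P^{inv}(X)=\{T\in\Sigma_P(X): TP=P\}$, and $\Sigma_P^u(X)=\{T\in\Sigma_P(X): \|T^n-P\|\to0 \text{ as } n\to\infty\}$; one has $\Sigma_P^u(X)\subseteq\Sigma_P^{inv}(X)$. Dense and open refer to the operator norm topology. *)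

theory Defs
  imports "HOL-Analysis.Analysis"
begin

definition state_base :: "('a::ordered_real_vector \<Rightarrow> real) \<Rightarrow> 'a set" where
  "state_base f = {x. 0 \<le> x \<and> f x = 1}"

definition state_ball :: "('a::ordered_real_vector \<Rightarrow> real) \<Rightarrow> 'a set" where
  "state_ball f = convex hull (state_base f \<union> uminus ` state_base f)"

definition base_norm :: "('a::ordered_real_vector \<Rightarrow> real) \<Rightarrow> 'a \<Rightarrow> real" where
  "base_norm f x = Inf {t. 0 \<le> t \<and> x \<in> (\<lambda>u. t *\<^sub>R u) ` state_ball f}"

text \<open>
  The order of the type is the one given by the cone \<open>{x. 0 \<le> x}\<close>.  That the gauge of
  \<open>state_ball f\<close> is a norm for which the space is complete is expressed by
  identifying it with the norm of the class \<^class>\<open>banach\<close>.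
\<close>

locale abstract_state_space =
  fixes f :: "'a::{banach, ordered_real_vector} \<Rightarrow> real"
  assumes linear_functional: "linear f"
    and strictly_positive: "\<And>x. 0 < x \<Longrightarrow> 0 < f x"
    and generating_cone: "\<And>x::'a. \<exists>y z. 0 \<le> y \<and> 0 \<le> z \<and> x = y - z"
    and closed_cone: "closed {x::'a. 0 \<le> x}"
    and norm_eq_base_norm: "\<And>x. norm x = base_norm f x"

definition markov :: "('a::ordered_real_vector \<Rightarrow> real) \<Rightarrow> ('a \<Rightarrow> 'a) \<Rightarrow> bool" where
  "markov f T \<longleftrightarrow> linear T \<and> (\<forall>x. 0 \<le> x \<longrightarrow> 0 \<le> T x) \<and> T ` state_base f \<subseteq> state_base f"

text \<open>
  The infimum in \<^const>\<open>base_norm\<close> is never taken over the empty set, except on the zero space.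
\<close>

lemma (in abstract_state_space) state_ball_absorbing:
  assumes "x \<noteq> 0"
  shows "\<exists>t\<ge>0. x \<in> (\<lambda>u. t *\<^sub>R u) ` state_ball f"
proof -
  interpret f: linear f by (rule linear_functional)
  have base: "\<exists>w\<in>state_base f. y = f y *\<^sub>R w" if "0 \<le> y" "state_base f \<noteq> {}" for y
  proof (cases "y = 0")
    case True
    with that show ?thesis by (auto simp: f.zero)
  next
    case False
    with that have p: "0 < f y" by (intro strictly_positive) auto
    have "inverse (f y) *\<^sub>R y \<in> state_base f"
      using p that by (auto simp: state_base_def f.scaleR intro!: scaleR_nonneg_nonneg)
    moreover have "y = f y *\<^sub>R (inverse (f y) *\<^sub>R y)" using p by simp
    ultimately show ?thesis by blast
  qed
  have nonneg: "0 \<le> f y" if "0 \<le> y" for y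
    using that strictly_positive[of y] f.zero by (cases "y = 0") (auto simp: less_le)
  obtain y z where yz: "0 \<le> y" "0 \<le> z" "x = y - z" using generating_cone by blast
  from yz assms have "0 < y \<or> 0 < z" by (auto simp: less_le)
  then obtain v :: 'a where v: "0 < v" by blast
  then have "inverse (f v) *\<^sub>R v \<in> state_base f"
    using strictly_positive[OF v]
    by (auto simp: state_base_def f.scaleR intro!: scaleR_nonneg_nonneg)
  then have ne: "state_base f \<noteq> {}" by blast
  define s where "s = f y + f z"
  have s: "0 < s"
    using \<open>0 < y \<or> 0 < z\<close> strictly_positive[of y] strictly_positive[of z] nonneg yz
    unfolding s_def by (meson add_nonneg_pos add_pos_nonneg)
  obtain a where a: "a \<in> state_base f" "y = f y *\<^sub>R a" using base[OF yz(1) ne] by blast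
  obtain b where b: "b \<in> state_base f" "z = f z *\<^sub>R b" using base[OF yz(2) ne] by blast
  have "(f y / s) *\<^sub>R a + (f z / s) *\<^sub>R (- b) \<in> state_ball f"
    unfolding state_ball_def
    by (rule convexD[OF convex_convex_hull])
       (use a b s nonneg yz in \<open>auto intro!: hull_inc simp: s_def add_divide_distrib[symmetric]\<close>)
  moreover have "x = s *\<^sub>R ((f y / s) *\<^sub>R a + (f z / s) *\<^sub>R (- b))"
    using s a(2) b(2) yz(3) by (simp add: algebra_simps)
  ultimately show ?thesis using s by (intro exI[of _ s]) auto
qed

text \<open>
  Markov operators are contractions, so no operator is lost by working below in the
  type of bounded linear operators, whose norm is the operator norm.
\<close>

lemma (in abstract_state_space) markov_contraction:
  assumes "markov f T"
  shows "norm (T x) \<le> norm x"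
proof (cases "x = 0")
  case True
  with assms show ?thesis by (simp add: markov_def linear_0)
next
  case False
  have T: "linear T" "T ` state_base f \<subseteq> state_base f" using assms by (auto simp: markov_def)
  have "T ` (state_base f \<union> uminus ` state_base f) \<subseteq> state_base f \<union> uminus ` state_base f"
    using T by (auto simp: linear_neg)
  then have ball: "T ` state_ball f \<subseteq> state_ball f"
    unfolding state_ball_def convex_hull_linear_image[OF T(1)] by (rule hull_mono)
  have "norm (T x) \<le> t" if t: "0 \<le> t" "x \<in> (\<lambda>u. t *\<^sub>R u) ` state_ball f" for t
    unfolding norm_eq_base_norm base_norm_def
  proof (rule cInf_lower)
    show "t \<in> {t. 0 \<le> t \<and> T x \<in> (\<lambda>u. t *\<^sub>R u) ` state_ball f}"
      using t ball by (auto simp: linear_scale[OF T(1)] intro!: imageI)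
    show "bdd_below {t. 0 \<le> t \<and> T x \<in> (\<lambda>u. t *\<^sub>R u) ` state_ball f}"
      by (rule bdd_belowI[of _ 0]) auto
  qed
  then show ?thesis
    unfolding norm_eq_base_norm[of x] base_norm_def
    using state_ball_absorbing[OF False] by (intro cInf_greatest) auto
qed

lemma (in abstract_state_space) markov_bounded_linear:
  assumes "markov f T"
  shows "bounded_linear T"
proof -
  interpret T: linear T using assms by (simp add: markov_def)
  show ?thesis
    by (rule bounded_linear_intro[where K = 1])
       (use markov_contraction[OF assms] in \<open>auto simp: T.add T.scaleR\<close>)
qed

definition markov_projection ::
    "('a::{real_normed_vector, ordered_real_vector} \<Rightarrow> real) \<Rightarrow> ('a \<Rightarrow>\<^sub>L 'a) \<Rightarrow> bool" where
  "markov_projection f P \<longleftrightarrow> markov f (blinfun_apply P) \<and> P o\<^sub>L P = P"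

primrec blinfun_power :: "('a::real_normed_vector \<Rightarrow>\<^sub>L 'a) \<Rightarrow> nat \<Rightarrow> ('a \<Rightarrow>\<^sub>L 'a)" where
  "blinfun_power T 0 = id_blinfun"
| "blinfun_power T (Suc n) = T o\<^sub>L blinfun_power T n"

definition Sigma_comm ::
    "('a::{real_normed_vector, ordered_real_vector} \<Rightarrow> real) \<Rightarrow> ('a \<Rightarrow>\<^sub>L 'a) \<Rightarrow> ('a \<Rightarrow>\<^sub>L 'a) set" where
  "Sigma_comm f P = {T. markov f (blinfun_apply T) \<and> T o\<^sub>L P = P o\<^sub>L T}"

definition Sigma_inv ::
    "('a::{real_normed_vector, ordered_real_vector} \<Rightarrow> real) \<Rightarrow> ('a \<Rightarrow>\<^sub>L 'a) \<Rightarrow> ('a \<Rightarrow>\<^sub>L 'a) set" where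
  "Sigma_inv f P = {T \<in> Sigma_comm f P. T o\<^sub>L P = P}"

definition Sigma_unif ::
    "('a::{real_normed_vector, ordered_real_vector} \<Rightarrow> real) \<Rightarrow> ('a \<Rightarrow>\<^sub>L 'a) \<Rightarrow> ('a \<Rightarrow>\<^sub>L 'a) set" where
  "Sigma_unif f P = {T \<in> Sigma_comm f P. (\<lambda>n. norm (blinfun_power T n - P)) \<longlonglongrightarrow> 0}"

end

theory Submission
  imports Defs
begin

text \<open>
  Let \<open>T\<close> be a Markov operator with \<open>T P = P T = P\<close>, and put \<open>d n = \<parallel>T\<^sup>n - P\<parallel>\<close>.  Because \<open>P\<close> absorbs
  every power of \<open>T\<close>, \<open>(T\<^sup>m - P) (T\<^sup>n - P) = T\<^sup>m\<^sup>+\<^sup>n - P\<close>, so \<open>d\<close> is submultiplicative; and since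
  Markov operators are contractions, \<open>d\<close> is decreasing.  Hence \<open>d\<close> tends to \<open>0\<close> as soon as a single
  value \<open>d n\<close> is below \<open>1\<close> (\<open>Sigma_unif_iff\<close>).

  The criterion gives both topological assertions.  For each fixed \<open>n\<close> the condition
  \<open>\<parallel>T\<^sup>n - P\<parallel> < 1\<close> is open in \<open>T\<close>, and \<open>Sigma_unif f P\<close> is the part of \<open>Sigma_inv f P\<close> in the union
  of these open sets.  For density, move \<open>T\<close> a little towards \<open>P\<close>: the operator
  \<open>S = c T + (1 - c) P\<close> with \<open>0 \<le> c < 1\<close> is Markov, and \<open>S\<^sup>n - P = c\<^sup>n (T\<^sup>n - P)\<close> is small for large \<open>n\<close>.
\<close>

section \<open>Powers of an operator that a projection absorbs\<close>

lemma blinfun_compose_assoc: "(A o\<^sub>L B) o\<^sub>L C = A o\<^sub>L (B o\<^sub>L C)"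
  by (rule blinfun_eqI) simp

lemma blinfun_compose_id [simp]: "A o\<^sub>L id_blinfun = A" "id_blinfun o\<^sub>L A = A"
  by (simp_all add: blinfun_eqI)

lemmas blinfun_compose_simps =
  bounded_bilinear.add_left[OF bounded_bilinear_blinfun_compose]
  bounded_bilinear.add_right[OF bounded_bilinear_blinfun_compose]
  bounded_bilinear.diff_left[OF bounded_bilinear_blinfun_compose]
  bounded_bilinear.diff_right[OF bounded_bilinear_blinfun_compose]
  bounded_bilinear.scaleR_left[OF bounded_bilinear_blinfun_compose]
  bounded_bilinear.scaleR_right[OF bounded_bilinear_blinfun_compose]

lemma blinfun_power_commute:
  assumes "T o\<^sub>L P = P o\<^sub>L T"
  shows "blinfun_power T n o\<^sub>L P = P o\<^sub>L blinfun_power T n"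
proof (induction n)
  case (Suc n)
  have "blinfun_power T (Suc n) o\<^sub>L P = (T o\<^sub>L P) o\<^sub>L blinfun_power T n"
    by (simp add: blinfun_compose_assoc Suc)
  also have "\<dots> = P o\<^sub>L blinfun_power T (Suc n)"
    by (simp add: assms blinfun_compose_assoc)
  finally show ?case .
qed simp

lemma blinfun_power_absorb:
  assumes "T o\<^sub>L P = P"
  shows "blinfun_power T n o\<^sub>L P = P"
  using assms by (induction n) (simp_all add: blinfun_compose_assoc)

lemma blinfun_power_add:
  "blinfun_power T (m + n) = blinfun_power T m o\<^sub>L blinfun_power T n"
  by (induction m) (simp_all add: blinfun_compose_assoc)

text \<open>
  Every power of \<open>T\<close> is the identity on the range of \<open>P\<close>, so \<open>T\<^sup>n - P\<close> vanishes there and agrees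
  with \<open>T\<^sup>n\<close> on the kernel of \<open>P\<close>, which \<open>T\<close> maps into itself.  This stays true for \<open>n = 0\<close>, where
  the difference is the complementary projection.
\<close>

lemma blinfun_power_diff_mult:
  assumes "T o\<^sub>L P = P" "P o\<^sub>L T = P" "P o\<^sub>L P = P"
  shows "(blinfun_power T m - P) o\<^sub>L (blinfun_power T n - P) = blinfun_power T (m + n) - P"
proof -
  have "blinfun_power T m o\<^sub>L P = P" "P o\<^sub>L blinfun_power T n = P"
    using assms blinfun_power_absorb[of T P] blinfun_power_commute[of T P] by simp_all
  then show ?thesis
    using assms(3)
    by (simp add: blinfun_compose_simps blinfun_power_add)
qed

text \<open>
  On the range of \<open>P\<close> the combination acts as the identity, and on the kernel of \<open>P\<close> as \<open>c T\<close>.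
\<close>

lemma blinfun_power_convex_combination:
  assumes "T o\<^sub>L P = P" "P o\<^sub>L T = P" "P o\<^sub>L P = P"
  shows "blinfun_power (c *\<^sub>R T + (1 - c) *\<^sub>R P) n - P = c ^ n *\<^sub>R (blinfun_power T n - P)"
proof (induction n)
  case (Suc n)
  have "P o\<^sub>L blinfun_power T n = P"
    using assms blinfun_power_absorb[of T P] blinfun_power_commute[of T P] by simp
  then have "(c *\<^sub>R T + (1 - c) *\<^sub>R P) o\<^sub>L (c ^ n *\<^sub>R (blinfun_power T n - P) + P)
      = c ^ Suc n *\<^sub>R (blinfun_power T (Suc n) - P) + P"
    using assms by (simp add: blinfun_compose_simps algebra_simps)
  moreover have "blinfun_power (c *\<^sub>R T + (1 - c) *\<^sub>R P) n
      = c ^ n *\<^sub>R (blinfun_power T n - P) + P"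
    using Suc by (metis diff_add_cancel)
  ultimately show ?case by simp
qed simp

lemma continuous_on_blinfun_power: "continuous_on A (\<lambda>T. blinfun_power T n)"
  by (induction n)
     (auto intro!: continuous_intros
        bounded_bilinear.continuous_on[OF bounded_bilinear_blinfun_compose])

section \<open>Submultiplicative sequences\<close>

lemma LIMSEQ_zero_ex_less:
  fixes X :: "nat \<Rightarrow> real"
  assumes "X \<longlonglongrightarrow> 0" "0 < e"
  shows "\<exists>n. X n < e"
  using order_tendstoD(2)[OF assms] by (auto simp: eventually_sequentially)

text \<open>
  Submultiplicativity makes \<open>d\<close> decay geometrically along the multiples of \<open>N\<close>, and monotonicity
  fills the gaps.
\<close>

lemma tendsto_zero_if_decseq_submultiplicative:
  fixes d :: "nat \<Rightarrow> real"
  assumes "decseq d" and nonneg: "\<And>n. 0 \<le> d n"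
    and mult: "\<And>m n. d (m + n) \<le> d m * d n" and "d N < 1"
  shows "d \<longlonglongrightarrow> 0"
proof (rule LIMSEQ_I)
  fix e :: real
  assume "0 < e"
  have le: "d (k * N) \<le> d N ^ k * d 0" for k
  proof (induction k)
    case (Suc k)
    have "d (Suc k * N) \<le> d N * d (k * N)" using mult[of N "k * N"] by simp
    also have "\<dots> \<le> d N * (d N ^ k * d 0)" by (intro mult_left_mono Suc nonneg)
    finally show ?case by (simp add: mult.assoc)
  qed simp
  have "(\<lambda>k. d N ^ k * d 0) \<longlonglongrightarrow> 0"
    using nonneg \<open>d N < 1\<close> by (intro tendsto_mult_left_zero LIMSEQ_realpow_zero) auto
  then obtain k where k: "d N ^ k * d 0 < e"
    using LIMSEQ_zero_ex_less \<open>0 < e\<close> by blast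
  have "norm (d n - 0) < e" if "k * N \<le> n" for n
    using decseqD[OF \<open>decseq d\<close> that] le[of k] k nonneg[of n] by simp
  then show "\<exists>n0. \<forall>n\<ge>n0. norm (d n - 0) < e" by blast
qed

section \<open>Uniformly stable Markov operators\<close>

lemma Sigma_invD:
  assumes "T \<in> Sigma_inv f P"
  shows "markov f (blinfun_apply T)" "T o\<^sub>L P = P" "P o\<^sub>L T = P"
  using assms by (auto simp: Sigma_inv_def Sigma_comm_def)

lemma Sigma_unif_subset_inv: "Sigma_unif f P \<subseteq> Sigma_inv f P"
proof
  fix T assume T: "T \<in> Sigma_unif f P"
  (* Both sides of T T^n = T^(n+1) converge, the left one to T P and the right one to P. *)
  then have lim: "(\<lambda>n. blinfun_power T n) \<longlonglongrightarrow> P"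
    by (simp add: Sigma_unif_def tendsto_norm_zero_iff LIM_zero_iff)
  then have "(\<lambda>n. T o\<^sub>L blinfun_power T n) \<longlonglongrightarrow> (T o\<^sub>L P)"
    by (intro bounded_bilinear.tendsto[OF bounded_bilinear_blinfun_compose] tendsto_const)
  moreover have "(\<lambda>n. T o\<^sub>L blinfun_power T n) \<longlonglongrightarrow> P"
    using LIMSEQ_Suc[OF lim] by simp
  ultimately have "T o\<^sub>L P = P" by (rule LIMSEQ_unique)
  then show "T \<in> Sigma_inv f P" using T by (simp add: Sigma_unif_def Sigma_inv_def)
qed

context abstract_state_space
begin

lemma markov_norm_le_1:
  assumes "markov f (blinfun_apply T)"
  shows "norm T \<le> 1"
  using markov_contraction[OF assms] by (intro norm_blinfun_bound) auto

lemma markov_convex_combination: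
  assumes "markov f S" "markov f T" "0 \<le> c" "c \<le> 1"
  shows "markov f (\<lambda>x. c *\<^sub>R S x + (1 - c) *\<^sub>R T x)"
proof -
  interpret f: linear f by (rule linear_functional)
  have "linear (\<lambda>x. c *\<^sub>R S x + (1 - c) *\<^sub>R T x)"
    using assms by (intro linear_compose_add linear_compose_scale_right) (auto simp: markov_def)
  moreover have "0 \<le> c *\<^sub>R S x + (1 - c) *\<^sub>R T x" if "0 \<le> x" for x
    using assms that by (intro add_nonneg_nonneg scaleR_nonneg_nonneg) (auto simp: markov_def)
  moreover have "f (c *\<^sub>R S x + (1 - c) *\<^sub>R T x) = 1" if "x \<in> state_base f" for x
  proof -
    have "f (S x) = 1" "f (T x) = 1"
      using assms(1,2) that by (auto simp: markov_def state_base_def)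
    then show ?thesis by (simp add: f.add f.scaleR)
  qed
  ultimately show ?thesis by (auto simp: markov_def state_base_def)
qed

lemma decseq_norm_blinfun_power_diff:
  assumes "T \<in> Sigma_inv f P"
  shows "decseq (\<lambda>n. norm (blinfun_power T n - P))"
proof (rule decseq_SucI)
  fix n
  have "blinfun_power T (Suc n) - P = T o\<^sub>L (blinfun_power T n - P)"
    using Sigma_invD(2)[OF assms]
    by (simp add: blinfun_compose_simps)
  then have "norm (blinfun_power T (Suc n) - P) \<le> norm T * norm (blinfun_power T n - P)"
    by (metis norm_blinfun_compose)
  also have "\<dots> \<le> 1 * norm (blinfun_power T n - P)"
    by (intro mult_right_mono markov_norm_le_1 Sigma_invD(1)[OF assms]) simp
  finally show "norm (blinfun_power T (Suc n) - P) \<le> norm (blinfun_power T n - P)" by simp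
qed

text \<open>
  The limit condition that defines \<^const>\<open>Sigma_unif\<close> involves all powers of \<open>T\<close> at once; this
  replaces it by a condition on a single power, which survives small perturbations of \<open>T\<close>.
\<close>

lemma Sigma_unif_iff:
  assumes "P o\<^sub>L P = P"
  shows "T \<in> Sigma_unif f P \<longleftrightarrow> T \<in> Sigma_inv f P \<and> (\<exists>n. norm (blinfun_power T n - P) < 1)"
proof
  assume T: "T \<in> Sigma_unif f P"
  then have "(\<lambda>n. norm (blinfun_power T n - P)) \<longlonglongrightarrow> 0" by (simp add: Sigma_unif_def)
  then have "\<exists>n. norm (blinfun_power T n - P) < 1"
    by (rule LIMSEQ_zero_ex_less) simp
  then show "T \<in> Sigma_inv f P \<and> (\<exists>n. norm (blinfun_power T n - P) < 1)"
    using T Sigma_unif_subset_inv by blast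
next
  assume "T \<in> Sigma_inv f P \<and> (\<exists>n. norm (blinfun_power T n - P) < 1)"
  then obtain N where T: "T \<in> Sigma_inv f P" and N: "norm (blinfun_power T N - P) < 1" by blast
  have "norm (blinfun_power T (m + n) - P)
      \<le> norm (blinfun_power T m - P) * norm (blinfun_power T n - P)" for m n
    using blinfun_power_diff_mult[OF Sigma_invD(2,3)[OF T] assms] norm_blinfun_compose by metis
  then have "(\<lambda>n. norm (blinfun_power T n - P)) \<longlonglongrightarrow> 0"
    using tendsto_zero_if_decseq_submultiplicative[OF decseq_norm_blinfun_power_diff[OF T]] N
    by simp
  with T show "T \<in> Sigma_unif f P" by (simp add: Sigma_unif_def Sigma_inv_def)
qed

text \<open>
  The powers converge because \<open>\<parallel>T\<^sup>n - P\<parallel>\<close> stays bounded by \<open>\<parallel>I - P\<parallel>\<close> while the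
  factor \<open>c\<^sup>n\<close> decays.
\<close>

lemma convex_combination_in_Sigma_unif:
  assumes P: "markov_projection f P" and T: "T \<in> Sigma_inv f P" and c: "0 \<le> c" "c < 1"
  shows "c *\<^sub>R T + (1 - c) *\<^sub>R P \<in> Sigma_unif f P"
proof -
  let ?S = "c *\<^sub>R T + (1 - c) *\<^sub>R P"
  have PP: "P o\<^sub>L P = P" and mP: "markov f (blinfun_apply P)"
    using P by (auto simp: markov_projection_def)
  have "blinfun_apply ?S = (\<lambda>x. c *\<^sub>R T x + (1 - c) *\<^sub>R P x)"
    by (simp add: fun_eq_iff blinfun.bilinear_simps)
  then have "markov f (blinfun_apply ?S)"
    using markov_convex_combination[OF Sigma_invD(1)[OF T] mP] c by simp
  moreover have "?S o\<^sub>L P = P" "P o\<^sub>L ?S = P"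
    using Sigma_invD(2,3)[OF T] PP
    by (simp_all add: blinfun_compose_simps scaleR_add_left[symmetric])
  ultimately have "?S \<in> Sigma_inv f P" by (simp add: Sigma_inv_def Sigma_comm_def)
  moreover have "\<exists>n. norm (blinfun_power ?S n - P) < 1"
  proof -
    have "(\<lambda>n. c ^ n * norm (id_blinfun - P)) \<longlonglongrightarrow> 0"
      using c by (intro tendsto_mult_left_zero LIMSEQ_realpow_zero)
    then obtain n where n: "c ^ n * norm (id_blinfun - P) < 1"
      using LIMSEQ_zero_ex_less zero_less_one by blast
    have "norm (blinfun_power T n - P) \<le> norm (id_blinfun - P)"
      using decseqD[OF decseq_norm_blinfun_power_diff[OF T], of 0 n] by simp
    then have "c ^ n * norm (blinfun_power T n - P) \<le> c ^ n * norm (id_blinfun - P)"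
      using c by (intro mult_left_mono) auto
    moreover have "norm (blinfun_power ?S n - P) = c ^ n * norm (blinfun_power T n - P)"
      using blinfun_power_convex_combination[OF Sigma_invD(2,3)[OF T] PP] c by simp
    ultimately show ?thesis using n by (intro exI[of _ n]) linarith
  qed
  ultimately show ?thesis using Sigma_unif_iff[OF PP] by blast
qed

lemma Sigma_inv_subset_closure_unif:
  assumes "markov_projection f P"
  shows "Sigma_inv f P \<subseteq> closure (Sigma_unif f P)"
proof
  fix T assume T: "T \<in> Sigma_inv f P"
  define c :: "nat \<Rightarrow> real" where "c n = 1 - inverse (real (Suc n))" for n
  have "c \<longlonglongrightarrow> 1 - 0"
    unfolding c_def by (intro tendsto_diff tendsto_const LIMSEQ_inverse_real_of_nat)
  then have "(\<lambda>n. c n *\<^sub>R T + (1 - c n) *\<^sub>R P) \<longlonglongrightarrow> 1 *\<^sub>R T + (1 - 1) *\<^sub>R P"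
    by (intro tendsto_intros) simp_all
  moreover have "c n *\<^sub>R T + (1 - c n) *\<^sub>R P \<in> Sigma_unif f P" for n
    by (rule convex_combination_in_Sigma_unif[OF assms T]) (simp_all add: c_def field_simps)
  ultimately show "T \<in> closure (Sigma_unif f P)"
    unfolding closure_sequential by (intro exI[of _ "\<lambda>n. c n *\<^sub>R T + (1 - c n) *\<^sub>R P"]) simp
qed

lemma openin_Sigma_unif:
  assumes "P o\<^sub>L P = P"
  shows "openin (top_of_set (Sigma_inv f P)) (Sigma_unif f P)"
proof -
  let ?G = "\<Union>n. {T. norm (blinfun_power T n - P) < 1}"
  have "open {T. norm (blinfun_power T n - P) < 1}" for n
    by (intro open_Collect_less continuous_intros continuous_on_blinfun_power)
  then have "open ?G" by blast
  moreover have "Sigma_unif f P = Sigma_inv f P \<inter> ?G"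
    using Sigma_unif_iff[OF assms] by auto
  ultimately show ?thesis by (auto simp: openin_open)
qed

end

theorem theorem4p12:
  fixes f :: "'a::{banach, ordered_real_vector} \<Rightarrow> real"
    and P :: "'a \<Rightarrow>\<^sub>L 'a"
  assumes "abstract_state_space f"
    and "markov_projection f P"
  shows "Sigma_unif f P \<subseteq> Sigma_inv f P
    \<and> Sigma_inv f P \<subseteq> closure (Sigma_unif f P)
    \<and> openin (top_of_set (Sigma_inv f P)) (Sigma_unif f P)"
proof -
  interpret abstract_state_space f by (rule assms(1))
  have "P o\<^sub>L P = P" using assms(2) by (simp add: markov_projection_def)
  then show ?thesis
    using Sigma_unif_subset_inv Sigma_inv_subset_closure_unif[OF assms(2)] openin_Sigma_unif
    by blast
qed

end
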